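(* Let $n,r\ge 1$ be integers and let $A,B,C_1,\dots,C_n$ be positive stable matrices in $\mathbb{C}^{r\times r}$ such that $\alpha(A)+\alpha(B)<2$ and $\beta(C_i)>1$ for $i=1,\dots,n$. Then the series $$F_{\mathcal{C}}[A,B;C_1,\dots,C_n;x_1,\dots,x_n]=\sum_{m_1,\dots,m_n=0}^{\infty}(A)_{m_1+\cdots+m_n}(B)_{m_1+\cdots+m_n}(C_1)_{m_1}^{-1}\cdots(C_n)_{m_n}^{-1}\,\frac{x_1^{m_1}\cdots x_n^{m_n}}{m_1!\cdots m_n!}$$ converges absolutely for all $x_1,\dots,x_n\in\mathbb{C}$ with $\sqrt{|x_1|}+\cdots+\sqrt{|x_n|}<1$.
   Context: For $M\in\mathbb{C}^{r\times r}$ with spectrum $\sigma(M)$, $\alpha(M)=\max\{\Re(z):z\in\sigma(M)\}$ and $\beta(M)=\min\{\Re(z):z\in\sigma(M)\}$; $M$ is positive stable if $\beta(M)>0$. The Pochhammer symbol is $(M)_0=I$ and $(M)_k=M(M+I)\cdots(M+(k-1)I)$ for $k\ge1$; $(M)_k^{-1}$ denotes the inverse matrix of $(M)_k$. Matrix products are taken in the written order (no commutativity is assumed). Absolute convergence means that the series of norms of the terms converges. *)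

theory Defs
  imports "HOL-Analysis.Analysis"
begin

definition spectrum :: "complex^'r^'r \<Rightarrow> complex set" where
  "spectrum M = {z. \<exists>v. v \<noteq> 0 \<and> M *v v = z *s v}"

text \<open>The spectrum of a complex matrix is finite, and nonempty because index types are
  nonempty, so both extrema below are attained.\<close>

definition spectral_alpha :: "complex^'r^'r \<Rightarrow> real" where
  "spectral_alpha M = Max (Re ` spectrum M)"

definition spectral_beta :: "complex^'r^'r \<Rightarrow> real" where
  "spectral_beta M = Min (Re ` spectrum M)"

definition positive_stable :: "complex^'r^'r \<Rightarrow> bool" where
  "positive_stable M \<longleftrightarrow> spectral_beta M > 0"

primrec matrix_pochhammer :: "complex^'r^'r \<Rightarrow> nat \<Rightarrow> complex^'r^'r" where
  "matrix_pochhammer M 0 = mat 1"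
| "matrix_pochhammer M (Suc k) = matrix_pochhammer M k ** (M + mat (of_nat k))"

text \<open>The ordered product \<open>X 1 ** X 2 ** \<dots> ** X n\<close>; matrices do not commute, so the library's
  set-indexed products do not apply.\<close>

primrec ordered_matrix_prod :: "(nat \<Rightarrow> complex^'r^'r) \<Rightarrow> nat \<Rightarrow> complex^'r^'r" where
  "ordered_matrix_prod X 0 = mat 1"
| "ordered_matrix_prod X (Suc k) = ordered_matrix_prod X k ** X (Suc k)"

text \<open>A complex scalar \<open>c\<close> multiplies a matrix as \<open>mat c\<close>, i.e. as \<open>c\<close> times the identity.\<close>

definition lauricella_C_term ::
  "nat \<Rightarrow> complex^'r^'r \<Rightarrow> complex^'r^'r \<Rightarrow> (nat \<Rightarrow> complex^'r^'r) \<Rightarrow> (nat \<Rightarrow> complex)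
    \<Rightarrow> (nat \<Rightarrow> nat) \<Rightarrow> complex^'r^'r" where
  "lauricella_C_term n A B C x m =
     matrix_pochhammer A (\<Sum>i=1..n. m i) ** matrix_pochhammer B (\<Sum>i=1..n. m i)
     ** ordered_matrix_prod (\<lambda>i. matrix_inv (matrix_pochhammer (C i) (m i))) n
     ** mat ((\<Prod>i=1..n. x i ^ m i) / (\<Prod>i=1..n. fact (m i)))"

text \<open>A multi-index \<open>(m\<^sub>1, \<dots>, m\<^sub>n)\<close> is a function on \<open>{1..n}\<close>, taken extensional (a fixed
  dummy value outside \<open>{1..n}\<close>) so that each one occurs exactly once. Norms of terms are in the library norm of
  \<open>complex^'r^'r\<close>, the Frobenius norm; on a fixed matrix space all norms are equivalent.\<close>

abbreviation multi_indices :: "nat \<Rightarrow> (nat \<Rightarrow> nat) set" where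
  "multi_indices n \<equiv> {1..n} \<rightarrow>\<^sub>E UNIV"

end

theory Submission
  imports Defs
begin

text \<open>
  Up to polynomial factors, matrix Pochhammer symbols grow like those of scalars. The operator
  norm of \<open>M + kI\<close> is at most \<open>k + c\<close>, where \<open>c\<close> is the operator norm of \<open>M\<close>, so \<open>(M)\<^sub>k\<close> has
  operator norm at most \<open>k! (k + 1)\<^sup>q\<close> for some \<open>q\<close> (\<open>matrix_pochhammer_growth\<close>). Likewise
  \<open>M + kI\<close> stretches every vector at least by the factor \<open>k - c\<close> once \<open>k > c\<close>, and for the
  finitely many smaller \<open>k\<close> by some positive factor because \<open>-k\<close> is not an eigenvalue of a
  positive stable matrix; so the inverse of \<open>(M)\<^sub>k\<close> has operator norm at most
  \<open>(k + 1)\<^sup>q / k!\<close> (\<open>matrix_inv_pochhammer_growth\<close>). Both bounds come from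
  \<open>prod_near_one_le_power\<close>: a product whose \<open>j\<close>-th factor is \<open>1 + O(1/j)\<close> grows at most
  polynomially. Operator norms are submultiplicative, so the order of the matrix factors is
  immaterial.

  Put \<open>N = m\<^sub>1 + \<dots> + m\<^sub>n\<close>, \<open>y\<^sub>i = sqrt \<bar>x\<^sub>i\<bar>\<close> and \<open>s = y\<^sub>1 + \<dots> + y\<^sub>n < 1\<close>. The term with index
  \<open>m\<close> is then bounded by a constant times \<open>(N + 1)\<^sup>p T\<^sup>2\<close>, where
  \<open>T = N! \<Prod>\<^sub>i y\<^sub>i ^ m\<^sub>i / m\<^sub>i!\<close>. The square roots enter here: there are two factorials
  \<open>N!\<close>, from \<open>A\<close> and \<open>B\<close>, and two copies of each \<open>m\<^sub>i!\<close>, from \<open>C\<^sub>i\<close> and from the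
  denominator. As \<open>T\<close> is one term in the multinomial expansion of \<open>s ^ N\<close>
  (\<open>multinomial_term_le\<close>), the bound is at most \<open>(N + 1)\<^sup>p s ^ (2 * N)\<close>. One factor \<open>s ^ N\<close>
  absorbs the polynomial (\<open>power_times_geometric_bounded\<close>); the other is the product of the
  \<open>s ^ m\<^sub>i\<close>, a product of convergent geometric series
  (\<open>geometric_summable_on_multi_indices\<close>).
\<close>

section \<open>Operator bounds for matrices\<close>

text \<open>A bound of the operator norm for the Euclidean norm on vectors. As a predicate it can be
  carried through products without ever naming the norm itself.\<close>

definition op_bound :: "complex^'r^'r \<Rightarrow> real \<Rightarrow> bool" where
  "op_bound M c \<longleftrightarrow> (\<forall>v. norm (M *v v) \<le> c * norm v)"

text \<open>The constant is the reciprocal of the usual lower bound, so that it is directly a bound of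
  the inverse matrix. Such bounds multiply along a product, so inverses need not be taken factor
  by factor.\<close>

definition lower_bound :: "complex^'r^'r \<Rightarrow> real \<Rightarrow> bool" where
  "lower_bound M d \<longleftrightarrow> (\<forall>v. norm v \<le> d * norm (M *v v))"

lemma norm_vector_smult: "norm (c *s v) = cmod c * norm (v :: complex^'r)"
  by (simp add: norm_vec_def norm_mult L2_set_right_distrib)

lemma mat_vector_mult: "mat c *v v = c *s (v :: complex^'r)"
  by (simp add: vec_eq_iff matrix_vector_mult_def mat_def if_distrib if_distribR cong: if_cong)

lemma op_bound_exists: "\<exists>c\<ge>0. op_bound M c"
proof -
  have "bounded_linear ((*v) M)" by simp
  then obtain K where "0 < K" "\<And>v. norm (M *v v) \<le> norm v * K"
    using bounded_linear.pos_bounded by blast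
  then show ?thesis
    by (intro exI[of _ K]) (auto simp: op_bound_def mult.commute)
qed

lemma op_bound_nonneg:
  assumes "op_bound (M :: complex^'r^'r) c"
  shows "0 \<le> c"
proof -
  obtain i :: 'r where True by simp
  have "0 \<le> norm (M *v axis i 1)" by simp
  also have "\<dots> \<le> c * norm (axis i 1 :: complex^'r)"
    using assms unfolding op_bound_def by blast
  finally show ?thesis by simp
qed

lemma op_bound_mono: "op_bound M c \<Longrightarrow> c \<le> d \<Longrightarrow> op_bound M d"
  unfolding op_bound_def by (meson mult_right_mono norm_ge_zero order_trans)

lemma op_bound_mult:
  assumes "op_bound M c" "op_bound N d"
  shows "op_bound (M ** N) (c * d)"
  unfolding op_bound_def
proof
  fix v
  have "norm (M *v (N *v v)) \<le> c * norm (N *v v)"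
    using assms(1) unfolding op_bound_def by blast
  also have "\<dots> \<le> c * (d * norm v)"
    using assms(2) op_bound_nonneg[OF assms(1)]
    by (intro mult_left_mono) (auto simp: op_bound_def)
  finally show "norm (M ** N *v v) \<le> c * d * norm v"
    by (simp add: matrix_vector_mul_assoc)
qed

lemma op_bound_mat: "op_bound (mat c) (cmod c)"
  by (simp add: op_bound_def mat_vector_mult norm_vector_smult)

lemma op_bound_add_mat:
  assumes "op_bound M c"
  shows "op_bound (M + mat z) (c + cmod z)"
  unfolding op_bound_def
proof
  fix v
  have "norm ((M + mat z) *v v) \<le> norm (M *v v) + norm (z *s v)"
    by (simp add: matrix_vector_mult_add_rdistrib mat_vector_mult norm_triangle_ineq)
  also have "\<dots> \<le> (c + cmod z) * norm v"
    using assms by (simp add: op_bound_def norm_vector_smult distrib_right)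
  finally show "norm ((M + mat z) *v v) \<le> (c + cmod z) * norm v" .
qed

text \<open>Every entry of a matrix is a component of the image of a unit vector, so an operator bound
  controls the Frobenius norm up to the number of entries.\<close>

lemma norm_le_op_bound:
  fixes M :: "complex^'r^'r"
  assumes "op_bound M c"
  shows "norm M \<le> (real CARD('r))\<^sup>2 * c"
proof -
  have entry: "norm (M $ i $ j) \<le> c" for i j
  proof -
    have "M $ i $ j = (M *v axis j 1) $ i"
      by (simp add: matrix_vector_mult_def axis_def if_distrib cong: if_cong)
    also have "norm \<dots> \<le> norm (M *v axis j 1)" by (rule Finite_Cartesian_Product.norm_nth_le)
    also have "\<dots> \<le> c * norm (axis j 1 :: complex^'r)"
      using assms unfolding op_bound_def by blast
    finally show ?thesis by simp
  qed
  have "norm M \<le> (\<Sum>i\<in>UNIV. norm (M $ i))"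
    unfolding norm_vec_def[of M] by (rule L2_set_le_sum) simp
  also have "\<dots> \<le> (\<Sum>i\<in>(UNIV::'r set). \<Sum>j\<in>(UNIV::'r set). norm (M $ i $ j))"
    unfolding norm_vec_def[of "M $ _"] by (intro sum_mono L2_set_le_sum) simp
  also have "\<dots> \<le> (\<Sum>i\<in>(UNIV::'r set). \<Sum>j\<in>(UNIV::'r set). c)"
    by (intro sum_mono entry)
  finally show ?thesis by (simp add: power2_eq_square)
qed

lemma lower_bound_mult:
  assumes "lower_bound M c" "lower_bound N d" "0 \<le> d"
  shows "lower_bound (M ** N) (c * d)"
  unfolding lower_bound_def
proof
  fix v
  have "norm v \<le> d * norm (N *v v)"
    using assms(2) unfolding lower_bound_def by blast
  also have "\<dots> \<le> d * (c * norm (M *v (N *v v)))"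
    using assms(1,3) unfolding lower_bound_def by (intro mult_left_mono) blast+
  finally show "norm v \<le> c * d * norm (M ** N *v v)"
    by (simp add: matrix_vector_mul_assoc mult_ac)
qed

lemma lower_bound_add_mat:
  assumes "op_bound M c" "c < cmod z"
  shows "lower_bound (M + mat z) (1 / (cmod z - c))"
  unfolding lower_bound_def
proof
  fix v
  have "cmod z * norm v = norm ((M + mat z) *v v - M *v v)"
    by (simp add: matrix_vector_mult_add_rdistrib mat_vector_mult norm_vector_smult)
  also have "\<dots> \<le> norm ((M + mat z) *v v) + c * norm v"
    using assms(1) norm_triangle_ineq4 unfolding op_bound_def
    by (smt (verit, best))
  finally show "norm v \<le> 1 / (cmod z - c) * norm ((M + mat z) *v v)"
    using assms(2) by (simp add: field_simps)
qed

lemma op_bound_matrix_inv: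
  assumes "lower_bound M d"
  shows "op_bound (matrix_inv M) d"
proof -
  have "inj ((*v) M)"
    unfolding vec.inj_iff_eq_0 using assms by (auto simp: lower_bound_def)
       (metis mult_zero_right norm_le_zero_iff norm_zero)
  then have "invertible M"
    by (metis invertible_left_inverse matrix_left_invertible_injective)
  then have "M ** matrix_inv M = mat 1"
    unfolding invertible_def matrix_inv_def by (rule someI2_ex) blast
  then have "M *v (matrix_inv M *v v) = v" for v
    by (simp add: matrix_vector_mul_assoc)
  then show ?thesis
    using assms unfolding op_bound_def lower_bound_def by metis
qed

section \<open>Spectrum and invertibility of shifts\<close>

text \<open>The minimum defining \<open>spectral_beta\<close> is informative only if the spectrum is finite. The
  spectrum is the zero set of the characteristic polynomial, which is not the zero polynomial
  because a number larger in modulus than an operator bound is no eigenvalue.\<close>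

lemma finite_spectrum: "finite (spectrum (M :: complex^'r^'r))"
proof -
  define P :: "complex poly" where
    "P = (\<Sum>p\<in>{p. p permutes (UNIV::'r set)}. of_int (sign p) *
            (\<Prod>i\<in>UNIV. [:M $ i $ p i, if i = p i then -1 else 0:]))"
  have P: "poly P z = det (M + mat (-z))" for z
    unfolding P_def det_def poly_sum poly_mult poly_prod
    by (intro sum.cong refl arg_cong2[of _ _ _ _ "(*)"] prod.cong)
       (auto simp: mat_def of_int_poly)
  have root_iff: "poly P z = 0 \<longleftrightarrow> z \<in> spectrum M" for z
  proof -
    have "poly P z = 0 \<longleftrightarrow> \<not> inj ((*v) (M + mat (-z)))"
      unfolding P using invertible_det_nz[of "M + mat (-z)"]
      by (metis invertible_left_inverse matrix_left_invertible_injective)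
    also have "\<dots> \<longleftrightarrow> (\<exists>v. v \<noteq> 0 \<and> M *v v = z *s v)"
      unfolding vec.inj_iff_eq_0
      by (auto simp: matrix_vector_mult_add_rdistrib mat_vector_mult)
    finally show ?thesis by (simp add: spectrum_def)
  qed
  obtain c where c: "c \<ge> 0" "op_bound M c" using op_bound_exists by blast
  define w where "w = - complex_of_real (c + 1)"
  have "w \<notin> spectrum M"
  proof
    assume "w \<in> spectrum M"
    then obtain v where v: "v \<noteq> 0" "M *v v = w *s v" by (auto simp: spectrum_def)
    have "cmod w * norm v \<le> c * norm v"
      using c v unfolding op_bound_def by (metis norm_vector_smult)
    moreover have "cmod w = c + 1" using c unfolding w_def norm_minus_cancel norm_of_real by simp
    ultimately show False using v by simp
  qed
  then have "P \<noteq> 0" using root_iff by force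
  then have "finite {z. poly P z = 0}" by (rule poly_roots_finite)
  then show ?thesis by (simp add: root_iff)
qed

text \<open>The numbers \<open>-k\<close> have nonpositive real part, so they are not eigenvalues and the shifted
  matrix is injective; a left inverse then supplies the bound.\<close>

lemma lower_bound_shift_exists:
  assumes "positive_stable M"
  shows "\<exists>d\<ge>0. lower_bound (M + mat (of_nat k)) d"
proof -
  have "- of_nat k \<notin> spectrum M"
  proof
    assume "- of_nat k \<in> spectrum M"
    then have "Re (- of_nat k) \<in> Re ` spectrum M" by (rule imageI)
    then have "spectral_beta M \<le> Re (- of_nat k)"
      unfolding spectral_beta_def using finite_spectrum[of M] by (intro Min_le) auto
    then show False using assms by (simp add: positive_stable_def)
  qed
  then have "inj ((*v) (M + mat (of_nat k)))"
    unfolding vec.inj_iff_eq_0 spectrum_def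
    by (auto simp: matrix_vector_mult_add_rdistrib mat_vector_mult eq_neg_iff_add_eq_0)
  then obtain N where N: "N ** (M + mat (of_nat k)) = mat 1"
    using matrix_left_invertible_injective by blast
  obtain d where "d \<ge> 0" "op_bound N d" using op_bound_exists by blast
  moreover from this have "lower_bound (M + mat (of_nat k)) d"
    unfolding lower_bound_def op_bound_def
    by (metis N matrix_vector_mul_assoc matrix_vector_mul_lid)
  ultimately show ?thesis by blast
qed

section \<open>Growth of matrix Pochhammer symbols\<close>

text \<open>By Bernoulli's inequality each factor is at most \<open>((j + 2) / (j + 1)) ^ q\<close>, and the product
  of these telescopes.\<close>

lemma prod_near_one_le_power:
  fixes e :: "nat \<Rightarrow> real"
  assumes "\<And>j. 0 \<le> e j" "\<And>j. e j \<le> 1 + real q / (real j + 1)"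
  shows "(\<Prod>j<k. e j) \<le> (real k + 1) ^ q"
proof (induction k)
  case 0
  then show ?case by simp
next
  case (Suc k)
  have "e k \<le> 1 + real q * (1 / (real k + 1))"
    using assms(2)[of k] by simp
  also have "\<dots> \<le> (1 + 1 / (real k + 1)) ^ q"
    by (rule Bernoulli_inequality) (simp add: order_trans[of _ 0])
  also have "1 + 1 / (real k + 1) = (real (Suc k) + 1) / (real k + 1)"
    by (simp add: field_simps)
  finally have e: "e k \<le> ((real (Suc k) + 1) / (real k + 1)) ^ q" .
  have "(\<Prod>j<Suc k. e j) \<le> (real k + 1) ^ q * ((real (Suc k) + 1) / (real k + 1)) ^ q"
    using Suc e assms(1) by (auto intro!: mult_mono prod_nonneg)
  also have "\<dots> = (real (Suc k) + 1) ^ q"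
    by (simp add: power_divide)
  finally show ?case .
qed

lemma prod_lessThan_Suc_eq_fact: "(\<Prod>j<k. real j + 1) = fact k"
  by (induction k) (auto simp: algebra_simps)

text \<open>The \<open>j\<close>-th factor is bounded by \<open>c + j\<close>. Dividing by \<open>j + 1\<close> splits off the factorial and
  leaves a factor \<open>1 + O(1/j)\<close>.\<close>

lemma matrix_pochhammer_growth:
  "\<exists>q. \<forall>k. op_bound (matrix_pochhammer M k) (fact k * (real k + 1) ^ q)"
proof -
  obtain c where c: "c \<ge> 0" "op_bound M c" using op_bound_exists by blast
  have bnd: "op_bound (matrix_pochhammer M k) (\<Prod>j<k. c + real j)" for k
  proof (induction k)
    case 0
    then show ?case using op_bound_mat[of 1] by simp
  next
    case (Suc k)
    then show ?case
      using op_bound_mult op_bound_add_mat[OF c(2), of "of_nat k"] by fastforce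
  qed
  define q where "q = nat \<lceil>c\<rceil>"
  have q: "c \<le> real q" unfolding q_def by linarith
  have "(\<Prod>j<k. c + real j) \<le> fact k * (real k + 1) ^ q" for k
  proof -
    have "(\<Prod>j<k. c + real j) = (\<Prod>j<k. real j + 1) * (\<Prod>j<k. (c + real j) / (real j + 1))"
      unfolding prod.distrib[symmetric] by (intro prod.cong) (auto simp: field_simps)
    also have "(\<Prod>j<k. real j + 1) = fact k"
      by (rule prod_lessThan_Suc_eq_fact)
    also have "(\<Prod>j<k. (c + real j) / (real j + 1)) \<le> (real k + 1) ^ q"
    proof (rule prod_near_one_le_power)
      show "(c + real j) / (real j + 1) \<le> 1 + real q / (real j + 1)" for j
      proof -
        have "(c + real j) / (real j + 1) \<le> (real j + 1 + real q) / (real j + 1)"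
          using q by (intro divide_right_mono) auto
        then show ?thesis by (simp add: add_divide_distrib)
      qed
    qed (use c in simp)
    finally show ?thesis by simp
  qed
  with bnd show ?thesis using op_bound_mono by blast
qed

text \<open>The bound of the \<open>j\<close>-th inverse factor is \<open>1 / (j - c)\<close> for large \<open>j\<close>. Multiplied by
  \<open>j + 1\<close>, to split off the factorial, it is \<open>1 + O(1/j)\<close>; the finitely many other factors
  are absorbed by enlarging the exponent.\<close>

lemma matrix_inv_pochhammer_growth:
  assumes "positive_stable M"
  shows "\<exists>q. \<forall>k. op_bound (matrix_inv (matrix_pochhammer M k)) ((real k + 1) ^ q / fact k)"
proof -
  obtain c where c: "c \<ge> 0" "op_bound M c" using op_bound_exists by blast
  obtain l where l: "\<And>k. 0 \<le> l k" "\<And>k. lower_bound (M + mat (of_nat k)) (l k)"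
    using lower_bound_shift_exists[OF assms] by metis
  define d where "d k = (if c < real k then 1 / (real k - c) else l k)" for k
  have d0: "0 \<le> d k" for k using l by (simp add: d_def)
  have d: "lower_bound (M + mat (of_nat k)) (d k)" for k
    using l lower_bound_add_mat[OF c(2), of "of_nat k"] by (auto simp: d_def)
  have bnd: "lower_bound (matrix_pochhammer M k) (\<Prod>j<k. d j)" for k
  proof (induction k)
    case 0
    then show ?case by (simp add: lower_bound_def)
  next
    case (Suc k)
    then show ?case using lower_bound_mult[OF _ d d0] by simp
  qed
  \<comment> \<open>From \<open>k0\<close> on, \<open>2 * (k - c)\<close> is at least \<open>k + 1\<close>, which gives the first summand of \<open>Q\<close>;
      the second summand serves the indices below \<open>k0\<close>.\<close>
  define k0 where "k0 = nat \<lceil>2 * c + 1\<rceil>"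
  define Q where "Q = 2 * (c + 1) + (\<Sum>k<k0. (real k + 1)\<^sup>2 * d k)"
  have step: "(real k + 1) * ((real k + 1) * d k - 1) \<le> Q" for k
  proof (cases "k < k0")
    case True
    have "(real k + 1) * ((real k + 1) * d k - 1) \<le> (real k + 1)\<^sup>2 * d k"
      by (simp add: algebra_simps power2_eq_square)
    also have "\<dots> \<le> (\<Sum>k<k0. (real k + 1)\<^sup>2 * d k)"
      using True d0 by (intro member_le_sum) auto
    also have "\<dots> \<le> Q" using c by (simp add: Q_def)
    finally show ?thesis .
  next
    case False
    then have k: "real k \<ge> 2 * c + 1" unfolding k0_def by linarith
    then have "(real k + 1) * ((real k + 1) * d k - 1) = (real k + 1) * (c + 1) / (real k - c)"
      using c by (simp add: d_def field_simps)
    also have "\<dots> \<le> 2 * (c + 1)"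
    proof -
      have "(c + 1) * (real k + 1) \<le> (c + 1) * (2 * (real k - c))"
        using k c by (intro mult_left_mono) auto
      then show ?thesis using k c by (simp only: pos_divide_le_eq mult_ac)
    qed
    also have "\<dots> \<le> Q"
      unfolding Q_def using d0 by (simp add: sum_nonneg)
    finally show ?thesis .
  qed
  define q where "q = nat \<lceil>Q\<rceil>"
  have q: "Q \<le> real q" unfolding q_def by linarith
  have "(\<Prod>j<k. d j) \<le> (real k + 1) ^ q / fact k" for k
  proof -
    have "fact k * (\<Prod>j<k. d j) = (\<Prod>j<k. (real j + 1) * d j)"
      by (simp only: prod.distrib prod_lessThan_Suc_eq_fact)
    also have "\<dots> \<le> (real k + 1) ^ q"
    proof (rule prod_near_one_le_power)
      show "(real j + 1) * d j \<le> 1 + real q / (real j + 1)" for j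
      proof -
        have "(real j + 1) * d j - 1 \<le> real q / (real j + 1)"
          using order_trans[OF step q, of j] by (simp only: pos_le_divide_eq mult.commute)
        then show ?thesis by simp
      qed
    qed (use d0 in auto)
    finally show ?thesis by (simp add: field_simps)
  qed
  with op_bound_matrix_inv[OF bnd] show ?thesis using op_bound_mono by blast
qed

section \<open>Scalar estimates\<close>

text \<open>The left-hand side is a single term of the multinomial expansion of the right-hand side.
  Splitting off the last variable turns this into one term of a binomial expansion.\<close>

lemma multinomial_term_le:
  fixes y :: "nat \<Rightarrow> real"
  assumes "\<And>i. i \<in> {1..n} \<Longrightarrow> 0 \<le> y i"
  shows "fact (\<Sum>i=1..n. m i) * (\<Prod>i=1..n. y i ^ m i / fact (m i))
    \<le> (\<Sum>i=1..n. y i) ^ (\<Sum>i=1..n. m i)"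
  using assms
proof (induction n)
  case 0
  then show ?case by simp
next
  case (Suc n)
  define a where "a = (\<Sum>i=1..n. m i)"
  define Y where "Y = (\<Sum>i=1..n. y i)"
  define b where "b = m (Suc n)"
  define z where "z = y (Suc n)"
  have z: "0 \<le> z" using Suc.prems unfolding z_def by simp
  have Y: "0 \<le> Y" using Suc.prems unfolding Y_def by (intro sum_nonneg) simp
  have IH: "fact a * (\<Prod>i=1..n. y i ^ m i / fact (m i)) \<le> Y ^ a"
    using Suc unfolding a_def Y_def by simp
  have "fact (a + b) * ((\<Prod>i=1..n. y i ^ m i / fact (m i)) * (z ^ b / fact b))
    = (fact (a + b) / (fact a * fact b)) * z ^ b * (fact a * (\<Prod>i=1..n. y i ^ m i / fact (m i)))"
    by simp
  also have "\<dots> \<le> (fact (a + b) / (fact a * fact b)) * z ^ b * Y ^ a"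
    using z by (intro mult_left_mono IH) auto
  also have "\<dots> = of_nat ((a + b) choose a) * Y ^ a * z ^ (a + b - a)"
    by (simp add: binomial_fact)
  also have "\<dots> \<le> (\<Sum>k\<le>a + b. of_nat ((a + b) choose k) * Y ^ k * z ^ (a + b - k))"
    using Y z by (intro member_le_sum[where f="\<lambda>k. of_nat ((a + b) choose k) * Y ^ k * z ^ (a + b - k)"]) auto
  also have "\<dots> = (Y + z) ^ (a + b)"
    by (simp add: binomial_ring)
  finally show ?case
    by (simp add: a_def b_def Y_def z_def)
qed

text \<open>Each factor \<open>N + 1\<close> is paid for by one square root of the geometric factor: with
  \<open>r = sqrt s\<close>, the number \<open>(N + 1) * r ^ N\<close> is at most \<open>1 + r + \<dots> + r ^ N\<close>.\<close>

lemma power_times_geometric_bounded: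
  fixes s :: real
  assumes "0 \<le> s" "s < 1"
  shows "\<exists>K. \<forall>N. (real N + 1) ^ q * s ^ N \<le> K"
  using assms
proof (induction q arbitrary: s)
  case 0
  then show ?case by (auto intro!: exI[of _ 1] power_le_one)
next
  case (Suc q)
  define r where "r = sqrt s"
  have r: "0 \<le> r" "r < 1" "s = r * r" using Suc.prems by (auto simp: r_def)
  obtain K where K: "\<And>N. (real N + 1) ^ q * r ^ N \<le> K" using Suc.IH r by blast
  have lin: "(real N + 1) * r ^ N \<le> 1 / (1 - r)" for N
  proof -
    have "(real N + 1) * r ^ N = (\<Sum>k\<le>N. r ^ N)" by simp
    also have "\<dots> \<le> (\<Sum>k\<le>N. r ^ k)"
      using r by (intro sum_mono power_decreasing) auto
    also have "\<dots> \<le> 1 / (1 - r)"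
      using r by (simp add: sum_gp0 divide_right_mono)
    finally show ?thesis .
  qed
  have "(real N + 1) ^ Suc q * s ^ N \<le> 1 / (1 - r) * K" for N
  proof -
    have "(real N + 1) ^ Suc q * s ^ N = ((real N + 1) * r ^ N) * ((real N + 1) ^ q * r ^ N)"
      by (simp add: r(3) power_mult_distrib mult_ac)
    also have "\<dots> \<le> 1 / (1 - r) * K"
      using r lin K by (intro mult_mono) auto
    finally show ?thesis .
  qed
  then show ?case by blast
qed

text \<open>A finite set of multi-indices lies in a box \<open>{..L}\<^sup>n\<close>, over which the sum factors into
  \<open>n\<close> partial sums of the geometric series.\<close>

lemma geometric_summable_on_multi_indices:
  fixes s :: real
  assumes "0 \<le> s" "s < 1"
  shows "(\<lambda>m. s ^ (\<Sum>i=1..n. m i)) summable_on multi_indices n"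
proof (rule nonneg_bounded_partial_sums_imp_summable_on)
  show "eventually (\<lambda>X. (\<Sum>m\<in>X. s ^ (\<Sum>i=1..n. m i)) \<le> (1 / (1 - s)) ^ n)
          (finite_subsets_at_top (multi_indices n))"
  proof (rule eventually_finite_subsets_at_top_weakI)
    fix X assume X: "finite X" "X \<subseteq> multi_indices n"
    have "finite (\<Union>m\<in>X. m ` {1..n})" using X by auto
    then obtain L where L: "(\<Union>m\<in>X. m ` {1..n}) \<subseteq> {..L}"
      by (meson finite_nat_set_iff_bounded_le subsetI atMost_iff)
    have "X \<subseteq> {1..n} \<rightarrow>\<^sub>E {..L}"
      using X(2) L by (force simp: PiE_iff)
    then have "(\<Sum>m\<in>X. s ^ (\<Sum>i=1..n. m i)) \<le> (\<Sum>m\<in>{1..n} \<rightarrow>\<^sub>E {..L}. s ^ (\<Sum>i=1..n. m i))"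
      using assms by (intro sum_mono2 finite_PiE) auto
    also have "\<dots> = (\<Prod>i=1..n. \<Sum>k\<le>L. s ^ k)"
      by (simp add: power_sum prod_sum_PiE del: prod_constant)
    also have "\<dots> \<le> (1 / (1 - s)) ^ n"
    proof -
      have "(\<Sum>k\<le>L. s ^ k) \<le> 1 / (1 - s)"
        using assms by (simp add: sum_gp0 divide_right_mono)
      moreover have "0 \<le> (\<Sum>k\<le>L. s ^ k)" using assms by (simp add: sum_nonneg)
      ultimately show ?thesis using power_mono by fastforce
    qed
    finally show "(\<Sum>m\<in>X. s ^ (\<Sum>i=1..n. m i)) \<le> (1 / (1 - s)) ^ n" .
  qed
qed (use assms in auto)

section \<open>Absolute convergence\<close>

lemma op_bound_ordered_matrix_prod:
  assumes "\<And>i. i \<in> {1..n} \<Longrightarrow> op_bound (X i) (b i)"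
  shows "op_bound (ordered_matrix_prod X n) (\<Prod>i=1..n. b i)"
  using assms
proof (induction n)
  case 0
  then show ?case using op_bound_mat[of 1] by simp
next
  case (Suc n)
  then show ?case by (auto intro!: op_bound_mult)
qed

theorem theorem3p7:
  fixes n :: nat
    and A B :: "complex^'r^'r"
    and C :: "nat \<Rightarrow> complex^'r^'r"
    and x :: "nat \<Rightarrow> complex"
  assumes "n \<ge> 1"
    and "positive_stable A" and "positive_stable B"
    and "\<And>i. i \<in> {1..n} \<Longrightarrow> positive_stable (C i)"
    and "spectral_alpha A + spectral_alpha B < 2"
    and "\<And>i. i \<in> {1..n} \<Longrightarrow> spectral_beta (C i) > 1"
    and "(\<Sum>i=1..n. sqrt (cmod (x i))) < 1"
  shows "(\<lambda>m. norm (lauricella_C_term n A B C x m)) summable_on multi_indices n"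
proof -
  obtain a where a: "\<And>k. op_bound (matrix_pochhammer A k) (fact k * (real k + 1) ^ a)"
    using matrix_pochhammer_growth by blast
  obtain b where b: "\<And>k. op_bound (matrix_pochhammer B k) (fact k * (real k + 1) ^ b)"
    using matrix_pochhammer_growth by blast
  have "\<forall>i\<in>{1..n}. \<exists>q. \<forall>k. op_bound (matrix_inv (matrix_pochhammer (C i) k))
      ((real k + 1) ^ q / fact k)"
    using matrix_inv_pochhammer_growth assms(4) by blast
  then obtain q where q: "\<And>i k. i \<in> {1..n} \<Longrightarrow>
      op_bound (matrix_inv (matrix_pochhammer (C i) k)) ((real k + 1) ^ q i / fact k)"
    by metis
  define y where "y i = sqrt (cmod (x i))" for i
  define s where "s = (\<Sum>i=1..n. y i)"
  have s: "0 \<le> s" "s < 1" using assms(7) by (auto simp: s_def y_def intro!: sum_nonneg)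
  define p where "p = a + b + (\<Sum>i=1..n. q i)"
  obtain K where K: "\<And>N. (real N + 1) ^ p * s ^ N \<le> K"
    using power_times_geometric_bounded[OF s] by blast
  define R where "R = (real CARD('r))\<^sup>2"
  have main: "norm (lauricella_C_term n A B C x m) \<le> R * K * s ^ (\<Sum>i=1..n. m i)" for m
  proof -
    define N where "N = (\<Sum>i=1..n. m i)"
    define F where "F = (\<Prod>i=1..n. fact (m i) :: real)"
    define G where "G = (\<Prod>i=1..n. (real (m i) + 1) ^ q i)"
    \<comment> \<open>The bound of the term is \<open>T\<^sup>2\<close> up to polynomial factors in \<open>N\<close>; \<open>T\<close> is a multinomial
        coefficient times a monomial in \<open>y\<close>.\<close>
    define T where "T = fact N * (\<Prod>i=1..n. y i ^ m i / fact (m i))"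
    have scalar: "cmod ((\<Prod>i=1..n. x i ^ m i) / (\<Prod>i=1..n. fact (m i)))
        = (\<Prod>i=1..n. y i ^ m i)\<^sup>2 / F"
    proof -
      have "cmod (x i ^ m i) = (y i ^ m i)\<^sup>2" for i
        by (simp add: y_def norm_power power2_eq_square flip: power_mult_distrib)
      then show ?thesis
        by (simp add: norm_divide F_def prod_power_distrib flip: prod_norm)
    qed
    have "op_bound (lauricella_C_term n A B C x m)
        (fact N * (real N + 1) ^ a * (fact N * (real N + 1) ^ b)
          * (\<Prod>i=1..n. (real (m i) + 1) ^ q i / fact (m i)) * ((\<Prod>i=1..n. y i ^ m i)\<^sup>2 / F))"
      unfolding lauricella_C_term_def scalar[symmetric] N_def[symmetric]
      by (intro op_bound_mult a b op_bound_ordered_matrix_prod op_bound_mat q)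
    also have "fact N * (real N + 1) ^ a * (fact N * (real N + 1) ^ b)
          * (\<Prod>i=1..n. (real (m i) + 1) ^ q i / fact (m i)) * ((\<Prod>i=1..n. y i ^ m i)\<^sup>2 / F)
        = (real N + 1) ^ (a + b) * G * T\<^sup>2"
      by (simp add: prod_dividef F_def G_def T_def power_add power2_eq_square mult_ac)
    finally have "norm (lauricella_C_term n A B C x m) \<le> R * ((real N + 1) ^ (a + b) * G * T\<^sup>2)"
      unfolding R_def by (rule norm_le_op_bound)
    also have "(real N + 1) ^ (a + b) * G * T\<^sup>2 \<le> (real N + 1) ^ p * (s ^ N)\<^sup>2"
    proof -
      have "G \<le> (\<Prod>i=1..n. (real N + 1) ^ q i)"
        unfolding G_def N_def
        by (intro prod_mono conjI power_mono add_right_mono of_nat_mono member_le_sum) auto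
      then have G: "G \<le> (real N + 1) ^ (\<Sum>i=1..n. q i)"
        by (simp add: power_sum)
      have "0 \<le> T" unfolding T_def y_def by (intro mult_nonneg_nonneg prod_nonneg) auto
      moreover have "T \<le> s ^ N"
        unfolding T_def s_def N_def by (rule multinomial_term_le) (simp add: y_def)
      ultimately have "T\<^sup>2 \<le> (s ^ N)\<^sup>2" by (intro power_mono)
      then show ?thesis
        unfolding p_def power_add[of _ "a + b"] using G
        by (intro mult_mono) (auto simp: G_def prod_nonneg)
    qed
    also have "\<dots> = ((real N + 1) ^ p * s ^ N) * s ^ N"
      by (simp add: power2_eq_square)
    also have "\<dots> \<le> K * s ^ N"
      using K s by (intro mult_right_mono) auto
    finally show ?thesis by (simp add: R_def N_def mult.assoc mult_left_mono)
  qed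
  show ?thesis
  proof (rule summable_on_comparison_test)
    show "(\<lambda>m. R * K * s ^ (\<Sum>i=1..n. m i)) summable_on multi_indices n"
      by (intro summable_on_cmult_right geometric_summable_on_multi_indices s)
  qed (use main in auto)
qed

end
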